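(* Let $\Omega$ be a set, let $S$ be a subsemigroup of $\Omega^\Omega$ that contains all the transformations of rank at most $2$, and let $\mathcal{T}$ be a topology on $S$ with respect to which $S$ is a semitopological semigroup. Then the following are equivalent. (1) $\mathcal{T}$ is Hausdorff. (2) $\mathcal{T}$ is $T_1$. (3) Every set of the form $[\sigma:\tau]\cap S$ is open in $\mathcal{T}$ (i.e., $\mathcal{T}$ contains the topology induced on $S$ by the pointwise topology on $\Omega^\Omega$). (4) Every set of the form $[\sigma:\tau]\cap S$ is closed in $\mathcal{T}$.
   Context: $\Omega^\Omega$ is the full transformation monoid of $\Omega$: all functions $\Omega\to\Omega$ under composition. Functions are written on the right of their arguments and composed left to right. The rank of $f\in\Omega^\Omega$ is the cardinality of its image $(\Omega)f$. For sequences $\sigma=(\sigma_0,\dots,\sigma_n)$ and $\tau=(\tau_0,\dots,\tau_n)$ of elements of $\Omega$ of the same finite length ($n\in\mathbb{N}$, $n \ge 0$), $[\sigma:\tau]=\{f\in\Omega^\Omega : (\sigma_i)f=\tau_i \text{ for all } 0\le i\le n\}$. The pointwise topology on $\Omega^\Omega$ is the topology with base the sets $[\sigma:\tau]$, i.e. the product topology on $\prod_\Omega\Omega$ with each factor $\Omega$ discrete. A semigroup $S$ with a topology is semitopological if for every $s\in S$ the right multiplication map $x\mapsto xs$ and the left multiplication map $x\mapsto sx$ are continuous maps $S\to S$. *)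

theory Defs
  imports "HOL-Analysis.Analysis"
begin

text \<open>
  A transformation of \<open>\<Omega>\<close> is an extensional function (it takes the value \<open>undefined\<close>
  outside \<open>\<Omega>\<close>), so that equality of transformations is equality of functions on \<open>\<Omega>\<close>
  and the set \<open>\<Omega>\<close> is allowed to be empty.
\<close>

definition full_transformations :: "'a set \<Rightarrow> ('a \<Rightarrow> 'a) set" where
  "full_transformations \<Omega> = \<Omega> \<rightarrow>\<^sub>E \<Omega>"

text \<open>
  Functions act on the right and compose from left to right:
  \<open>trans_mult \<Omega> f g\<close> is ``first \<open>f\<close>, then \<open>g\<close>''.
\<close>

definition trans_mult :: "'a set \<Rightarrow> ('a \<Rightarrow> 'a) \<Rightarrow> ('a \<Rightarrow> 'a) \<Rightarrow> ('a \<Rightarrow> 'a)" where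
  "trans_mult \<Omega> f g = compose \<Omega> g f"

definition transformation_subsemigroup :: "'a set \<Rightarrow> ('a \<Rightarrow> 'a) set \<Rightarrow> bool" where
  "transformation_subsemigroup \<Omega> S \<longleftrightarrow>
     S \<subseteq> full_transformations \<Omega> \<and> (\<forall>f\<in>S. \<forall>g\<in>S. trans_mult \<Omega> f g \<in> S)"

text \<open>The finiteness conjunct is needed because \<open>card\<close> is \<open>0\<close> on infinite sets.\<close>

definition rank_at_most :: "'a set \<Rightarrow> nat \<Rightarrow> ('a \<Rightarrow> 'a) \<Rightarrow> bool" where
  "rank_at_most \<Omega> n f \<longleftrightarrow> finite (f ` \<Omega>) \<and> card (f ` \<Omega>) \<le> n"

definition semitopological_semigroup :: "'b topology \<Rightarrow> ('b \<Rightarrow> 'b \<Rightarrow> 'b) \<Rightarrow> bool" where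
  "semitopological_semigroup T mul \<longleftrightarrow>
     (\<forall>x\<in>topspace T. \<forall>y\<in>topspace T. mul x y \<in> topspace T) \<and>
     (\<forall>x\<in>topspace T. \<forall>y\<in>topspace T. \<forall>z\<in>topspace T. mul (mul x y) z = mul x (mul y z)) \<and>
     (\<forall>s\<in>topspace T. continuous_map T T (\<lambda>x. mul x s) \<and> continuous_map T T (\<lambda>x. mul s x))"

text \<open>
  Pairs of sequences \<open>(\<sigma>\<^sub>0, \<dots>, \<sigma>\<^sub>n)\<close>, \<open>(\<tau>\<^sub>0, \<dots>, \<tau>\<^sub>n)\<close> with \<open>n \<ge> 0\<close>; repetitions are allowed.
\<close>

definition sequence_pair :: "'a set \<Rightarrow> 'a list \<Rightarrow> 'a list \<Rightarrow> bool" where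
  "sequence_pair \<Omega> \<sigma> \<tau> \<longleftrightarrow>
     \<sigma> \<noteq> [] \<and> length \<sigma> = length \<tau> \<and> set \<sigma> \<subseteq> \<Omega> \<and> set \<tau> \<subseteq> \<Omega>"

definition pointwise_basic :: "'a set \<Rightarrow> 'a list \<Rightarrow> 'a list \<Rightarrow> ('a \<Rightarrow> 'a) set" where
  "pointwise_basic \<Omega> \<sigma> \<tau> =
     {f \<in> full_transformations \<Omega>. \<forall>i < length \<sigma>. f (\<sigma> ! i) = \<tau> ! i}"

definition pointwise_topology :: "'a set \<Rightarrow> ('a \<Rightarrow> 'a) topology" where
  "pointwise_topology \<Omega> = product_topology (\<lambda>_. discrete_topology \<Omega>) \<Omega>"

end

theory Submission
  imports Defs
begin

text \<open>
  Write \<open>c\<^sub>x\<close> for the constant map with value \<open>x\<close>. For \<open>y \<noteq> z\<close> let \<open>h\<close> fix \<open>y\<close> and send every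
  other point to \<open>z\<close>. Then \<open>f \<mapsto> c\<^sub>x f h\<close> is a continuous map on \<open>S\<close> with values in
  \<open>{c\<^sub>y, c\<^sub>z}\<close>, and it takes the value \<open>c\<^sub>y\<close> exactly on \<open>[x : y]\<close>. If points are closed, then
  \<open>[x : y]\<close> is the preimage both of the closed set \<open>{c\<^sub>y}\<close> and of the open set \<open>S - {c\<^sub>z}\<close>,
  hence clopen. Conversely, a singleton \<open>{f}\<close> is the intersection of the sets \<open>[x : xf]\<close>, and
  these sets separate points.
\<close>

text \<open>The hypothesis \<open>\<sigma> \<noteq> []\<close> matters: an intersection over no
  indices would be \<open>UNIV\<close>, not \<open>S\<close>.\<close>

lemma pointwise_basic_Int_eq_INT:
  assumes "S \<subseteq> full_transformations \<Omega>" "\<sigma> \<noteq> []"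
  shows "pointwise_basic \<Omega> \<sigma> \<tau> \<inter> S = (\<Inter>i\<in>{..<length \<sigma>}. {f \<in> S. f (\<sigma> ! i) = \<tau> ! i})"
  using assms by (auto simp: pointwise_basic_def)

lemma pointwise_basic_singleton_Int:
  assumes "S \<subseteq> full_transformations \<Omega>"
  shows "pointwise_basic \<Omega> [x] [y] \<inter> S = {f \<in> S. f x = y}"
  using assms by (auto simp: pointwise_basic_def)

text \<open>Each \<open>[\<sigma>:\<tau>]\<close> is a finite nonempty intersection of sets given by
  sequences of length one. The property \<open>P\<close> is kept abstract so that one proof serves
  both openness and closedness.\<close>

lemma all_pointwise_basic_Int_iff:
  assumes S: "S \<subseteq> full_transformations \<Omega>"
    and Int: "\<And>\<A>. finite \<A> \<Longrightarrow> \<A> \<noteq> {} \<Longrightarrow> (\<And>A. A \<in> \<A> \<Longrightarrow> P A) \<Longrightarrow> P (\<Inter>\<A>)"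
  shows "(\<forall>\<sigma> \<tau>. sequence_pair \<Omega> \<sigma> \<tau> \<longrightarrow> P (pointwise_basic \<Omega> \<sigma> \<tau> \<inter> S)) \<longleftrightarrow>
    (\<forall>x\<in>\<Omega>. \<forall>y\<in>\<Omega>. P {f \<in> S. f x = y})"
proof (intro iffI allI impI ballI)
  fix x y
  assume H: "\<forall>\<sigma> \<tau>. sequence_pair \<Omega> \<sigma> \<tau> \<longrightarrow> P (pointwise_basic \<Omega> \<sigma> \<tau> \<inter> S)"
    and "x \<in> \<Omega>" "y \<in> \<Omega>"
  then have "sequence_pair \<Omega> [x] [y]"
    by (simp add: sequence_pair_def)
  with H have "P (pointwise_basic \<Omega> [x] [y] \<inter> S)"
    by blast
  then show "P {f \<in> S. f x = y}"
    by (simp add: pointwise_basic_singleton_Int[OF S])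
next
  fix \<sigma> \<tau>
  assume H: "\<forall>x\<in>\<Omega>. \<forall>y\<in>\<Omega>. P {f \<in> S. f x = y}" and sp: "sequence_pair \<Omega> \<sigma> \<tau>"
  have ne: "\<sigma> \<noteq> []"
    using sp by (simp add: sequence_pair_def)
  have "\<sigma> ! i \<in> \<Omega> \<and> \<tau> ! i \<in> \<Omega>" if "i < length \<sigma>" for i
    using sp that by (auto simp: sequence_pair_def dest: nth_mem)
  then have "P (\<Inter>i\<in>{..<length \<sigma>}. {f \<in> S. f (\<sigma> ! i) = \<tau> ! i})"
    using H ne by (intro Int) auto
  then show "P (pointwise_basic \<Omega> \<sigma> \<tau> \<inter> S)"
    by (simp only: pointwise_basic_Int_eq_INT[OF S ne])
qed

text \<open>Every subset of a discrete space is a union of points, so its preimage is a union of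
  fibres.\<close>

lemma continuous_map_discrete_topology_iff:
  "continuous_map X (discrete_topology D) f \<longleftrightarrow>
    f \<in> topspace X \<rightarrow> D \<and> (\<forall>y\<in>D. openin X {x \<in> topspace X. f x = y})"
proof (intro iffI conjI ballI)
  assume f: "continuous_map X (discrete_topology D) f"
  then show "f \<in> topspace X \<rightarrow> D"
    using continuous_map_funspace by fastforce
  fix y
  assume "y \<in> D"
  then show "openin X {x \<in> topspace X. f x = y}"
    using openin_continuous_map_preimage[OF f, of "{y}"] by simp
next
  assume R: "f \<in> topspace X \<rightarrow> D \<and> (\<forall>y\<in>D. openin X {x \<in> topspace X. f x = y})"
  have "openin X {x \<in> topspace X. f x \<in> U}" if "U \<subseteq> D" for U
  proof -
    have "{x \<in> topspace X. f x \<in> U} = (\<Union>y\<in>U. {x \<in> topspace X. f x = y})"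
      by auto
    moreover have "openin X (\<Union>y\<in>U. {x \<in> topspace X. f x = y})"
      using R that by (intro openin_Union) blast
    ultimately show ?thesis
      by (simp only:)
  qed
  then show "continuous_map X (discrete_topology D) f"
    using R by (auto simp: continuous_map_def)
qed

text \<open>Containment of topologies on \<open>S\<close> is continuity of the identity. Continuity
  into a product is checked at each coordinate, and the coordinate at \<open>x\<close> is evaluation
  at \<open>x\<close>, with values in a discrete space.\<close>

lemma pointwise_subtopology_coarser_iff:
  assumes S: "S \<subseteq> full_transformations \<Omega>" and T: "topspace T = S"
  shows "(\<forall>U. openin (subtopology (pointwise_topology \<Omega>) S) U \<longrightarrow> openin T U) \<longleftrightarrow>
    (\<forall>x\<in>\<Omega>. \<forall>y\<in>\<Omega>. openin T {f \<in> S. f x = y})"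
proof -
  have top: "topspace (subtopology (pointwise_topology \<Omega>) S) = S"
    using S by (auto simp: pointwise_topology_def full_transformations_def)
  have "(\<forall>U. openin (subtopology (pointwise_topology \<Omega>) S) U \<longrightarrow> openin T U) \<longleftrightarrow>
      continuous_map T (subtopology (pointwise_topology \<Omega>) S) id"
    by (rule topology_finer_continuous_id) (simp only: top T)
  also have "\<dots> \<longleftrightarrow> continuous_map T (pointwise_topology \<Omega>) id"
    by (auto simp: continuous_map_in_subtopology T)
  also have "\<dots> \<longleftrightarrow> (\<forall>x\<in>\<Omega>. continuous_map T (discrete_topology \<Omega>) (\<lambda>f. f x))"
    \<comment> \<open>The componentwise criterion also asks that values be extensional on
      \<open>\<Omega>\<close>, which \<open>S\<close> provides.\<close>
    using S T
    by (auto simp: pointwise_topology_def continuous_map_componentwise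
        full_transformations_def PiE_def)
  also have "\<dots> \<longleftrightarrow> (\<forall>x\<in>\<Omega>. \<forall>y\<in>\<Omega>. openin T {f \<in> S. f x = y})"
    using S T by (auto simp: continuous_map_discrete_topology_iff full_transformations_def)
  finally show ?thesis .
qed

lemma Hausdorff_space_if_point_sets_open:
  assumes S: "S \<subseteq> full_transformations \<Omega>" and T: "topspace T = S"
    and op: "\<And>x y. x \<in> \<Omega> \<Longrightarrow> y \<in> \<Omega> \<Longrightarrow> openin T {f \<in> S. f x = y}"
  shows "Hausdorff_space T"
  unfolding Hausdorff_space_def T
proof (intro allI impI, elim conjE)
  fix f g
  assume f: "f \<in> S" and g: "g \<in> S" and "f \<noteq> g"
  then have "f \<in> \<Omega> \<rightarrow>\<^sub>E \<Omega>" "g \<in> \<Omega> \<rightarrow>\<^sub>E \<Omega>"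
    using S by (auto simp: full_transformations_def)
  \<comment> \<open>Both maps are \<open>undefined\<close> outside \<open>\<Omega>\<close>, so they
    must differ at a point of \<open>\<Omega>\<close>.\<close>
  with \<open>f \<noteq> g\<close> obtain x where x: "x \<in> \<Omega>" "f x \<noteq> g x" "f x \<in> \<Omega>" "g x \<in> \<Omega>"
    by (metis PiE_ext PiE_mem)
  have "disjnt {k \<in> S. k x = f x} {k \<in> S. k x = g x}"
    using x by (auto simp: disjnt_def)
  then show "\<exists>U V. openin T U \<and> openin T V \<and> f \<in> U \<and> g \<in> V \<and> disjnt U V"
    using f g x op by (intro exI[of _ "{k \<in> S. k x = f x}"] exI[of _ "{k \<in> S. k x = g x}"]) auto
qed

lemma t1_space_if_point_sets_closed:
  assumes S: "S \<subseteq> full_transformations \<Omega>" and T: "topspace T = S"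
    and cl: "\<And>x y. x \<in> \<Omega> \<Longrightarrow> y \<in> \<Omega> \<Longrightarrow> closedin T {f \<in> S. f x = y}"
  shows "t1_space T"
  unfolding t1_space_closedin_singleton T
proof
  fix f
  assume f: "f \<in> S"
  then have fx: "f x \<in> \<Omega>" if "x \<in> \<Omega>" for x
    using S that by (auto simp: full_transformations_def)
  \<comment> \<open>\<open>insert S\<close> covers the empty \<open>\<Omega>\<close>, where the intersection would otherwise be \<open>UNIV\<close>.\<close>
  have "g = f" if "g \<in> S" "\<forall>x\<in>\<Omega>. g x = f x" for g
    using that f S by (metis PiE_ext full_transformations_def subsetD)
  then have "{f} = \<Inter>(insert S ((\<lambda>x. {g \<in> S. g x = f x}) ` \<Omega>))"
    using f by auto
  moreover have "closedin T (\<Inter>(insert S ((\<lambda>x. {g \<in> S. g x = f x}) ` \<Omega>)))"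
    using cl fx T closedin_topspace[of T] by (intro closedin_Inter) auto
  ultimately show "closedin T {f}"
    by simp
qed

lemma t1_imp_point_set_clopen:
  assumes S: "transformation_subsemigroup \<Omega> S"
    and rank2: "\<And>f. f \<in> full_transformations \<Omega> \<Longrightarrow> rank_at_most \<Omega> 2 f \<Longrightarrow> f \<in> S"
    and T: "topspace T = S"
    and semi: "semitopological_semigroup T (trans_mult \<Omega>)"
    and t1: "t1_space T"
    and x: "x \<in> \<Omega>" and y: "y \<in> \<Omega>"
  shows "openin T {f \<in> S. f x = y} \<and> closedin T {f \<in> S. f x = y}"
proof (cases "\<Omega> = {y}")
  \<comment> \<open>Here no second point \<open>z\<close> exists, but every element of
    \<open>S\<close> sends \<open>x\<close> to \<open>y\<close>.\<close>
  case True
  then have "{f \<in> S. f x = y} = topspace T"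
    using S x T by (auto simp: transformation_subsemigroup_def full_transformations_def)
  then show ?thesis
    by simp
next
  case False
  then obtain z where z: "z \<in> \<Omega>" "z \<noteq> y"
    using y by auto
  define c :: "'a \<Rightarrow> 'a \<Rightarrow> 'a" where "c a = restrict (\<lambda>_. a) \<Omega>" for a
  define h where "h = restrict (\<lambda>u. if u = y then y else z) \<Omega>"
  \<comment> \<open>The case \<open>a = b\<close> is allowed, so this covers the constant maps as
    well as \<open>h\<close>.\<close>
  have two: "f \<in> S" if "f \<in> \<Omega> \<rightarrow>\<^sub>E \<Omega>" "f ` \<Omega> \<subseteq> {a, b}" for f a b
  proof -
    have "finite (f ` \<Omega>)"
      using that(2) by (rule finite_subset) simp
    moreover have "card (f ` \<Omega>) \<le> card {a, b}"
      using that by (intro card_mono) simp_all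
    moreover have "card {a, b} \<le> 2"
      by (simp add: card_insert_if)
    ultimately show ?thesis
      using that(1) by (intro rank2) (simp_all add: full_transformations_def rank_at_most_def)
  qed
  have cS: "c a \<in> S" if "a \<in> \<Omega>" for a
    using that by (intro two[of _ a a]) (auto simp: c_def)
  have hS: "h \<in> S"
    using y z by (intro two[of _ y z]) (auto simp: h_def)
  define \<phi> where "\<phi> f = trans_mult \<Omega> (trans_mult \<Omega> (c x) f) h" for f
  have "continuous_map T T (\<lambda>f. trans_mult \<Omega> (c x) f)" "continuous_map T T (\<lambda>f. trans_mult \<Omega> f h)"
    using semi cS[OF x] hS unfolding semitopological_semigroup_def T by blast+
  \<comment> \<open>Left translation by \<open>c x\<close> is followed by right translation by
    \<open>h\<close>, so separate continuity suffices.\<close>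
  from continuous_map_compose[OF this] have cont: "continuous_map T T \<phi>"
    unfolding \<phi>_def o_def .
  \<comment> \<open>The product of \<open>c x\<close> and \<open>f\<close> is the constant map with
    value \<open>f x\<close>, and \<open>h\<close> then moves this value to \<open>y\<close> or
    \<open>z\<close>.\<close>
  have \<phi>: "\<phi> f = (if f x = y then c y else c z)" if "f \<in> S" for f
  proof -
    have "f x \<in> \<Omega>"
      using S that x by (auto simp: transformation_subsemigroup_def full_transformations_def)
    then show ?thesis
      using x by (auto simp: \<phi>_def trans_mult_def compose_def c_def h_def)
  qed
  have cyz: "c y \<noteq> c z"
    using x z by (auto simp: c_def dest: fun_cong[of _ _ x])
  have "closedin T {c y}" "closedin T {c z}"
    using t1 cS y z T by (auto simp: t1_space_closedin_singleton)
  then have "closedin T {f \<in> topspace T. \<phi> f \<in> {c y}} \<and>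
      openin T {f \<in> topspace T. \<phi> f \<in> topspace T - {c z}}"
    by (intro conjI closedin_continuous_map_preimage[OF cont]
        openin_continuous_map_preimage[OF cont] openin_diff openin_topspace)
  moreover have "{f \<in> topspace T. \<phi> f \<in> {c y}} = {f \<in> S. f x = y}"
    using \<phi> cyz T by auto
  moreover have "{f \<in> topspace T. \<phi> f \<in> topspace T - {c z}} = {f \<in> S. f x = y}"
    using \<phi> cyz T cS[OF y] by auto
  ultimately show ?thesis
    by simp
qed

theorem theorem3p1:
  fixes \<Omega> :: "'a set"
    and S :: "('a \<Rightarrow> 'a) set"
    and T :: "('a \<Rightarrow> 'a) topology"
  assumes "transformation_subsemigroup \<Omega> S"
    and "\<And>f. f \<in> full_transformations \<Omega> \<Longrightarrow> rank_at_most \<Omega> 2 f \<Longrightarrow> f \<in> S"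
    and "topspace T = S"
    and "semitopological_semigroup T (trans_mult \<Omega>)"
  shows "(Hausdorff_space T \<longleftrightarrow> t1_space T)
    \<and> (t1_space T \<longleftrightarrow>
         (\<forall>\<sigma> \<tau>. sequence_pair \<Omega> \<sigma> \<tau> \<longrightarrow> openin T (pointwise_basic \<Omega> \<sigma> \<tau> \<inter> S)))
    \<and> ((\<forall>\<sigma> \<tau>. sequence_pair \<Omega> \<sigma> \<tau> \<longrightarrow> openin T (pointwise_basic \<Omega> \<sigma> \<tau> \<inter> S)) \<longleftrightarrow>
         (\<forall>U. openin (subtopology (pointwise_topology \<Omega>) S) U \<longrightarrow> openin T U))
    \<and> ((\<forall>\<sigma> \<tau>. sequence_pair \<Omega> \<sigma> \<tau> \<longrightarrow> openin T (pointwise_basic \<Omega> \<sigma> \<tau> \<inter> S)) \<longleftrightarrow>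
         (\<forall>\<sigma> \<tau>. sequence_pair \<Omega> \<sigma> \<tau> \<longrightarrow> closedin T (pointwise_basic \<Omega> \<sigma> \<tau> \<inter> S)))"
proof -
  have S: "S \<subseteq> full_transformations \<Omega>"
    using assms(1) by (simp add: transformation_subsemigroup_def)
  have op: "(\<forall>\<sigma> \<tau>. sequence_pair \<Omega> \<sigma> \<tau> \<longrightarrow> openin T (pointwise_basic \<Omega> \<sigma> \<tau> \<inter> S)) \<longleftrightarrow>
      (\<forall>x\<in>\<Omega>. \<forall>y\<in>\<Omega>. openin T {f \<in> S. f x = y})"
    by (rule all_pointwise_basic_Int_iff[OF S]) (rule openin_Inter)
  have cl: "(\<forall>\<sigma> \<tau>. sequence_pair \<Omega> \<sigma> \<tau> \<longrightarrow> closedin T (pointwise_basic \<Omega> \<sigma> \<tau> \<inter> S)) \<longleftrightarrow>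
      (\<forall>x\<in>\<Omega>. \<forall>y\<in>\<Omega>. closedin T {f \<in> S. f x = y})"
    by (rule all_pointwise_basic_Int_iff[OF S]) (rule closedin_Inter)
  \<comment> \<open>The implications form two cycles through T1: one via Hausdorff and open fibres
    of evaluations, the other via closed fibres.\<close>
  have "t1_space T" if "Hausdorff_space T"
    using that by (rule Hausdorff_imp_t1_space)
  moreover have "(\<forall>x\<in>\<Omega>. \<forall>y\<in>\<Omega>. openin T {f \<in> S. f x = y}) \<and>
      (\<forall>x\<in>\<Omega>. \<forall>y\<in>\<Omega>. closedin T {f \<in> S. f x = y})" if "t1_space T"
    using t1_imp_point_set_clopen[OF assms that] by blast
  moreover have "Hausdorff_space T" if "\<forall>x\<in>\<Omega>. \<forall>y\<in>\<Omega>. openin T {f \<in> S. f x = y}"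
    using Hausdorff_space_if_point_sets_open[OF S assms(3)] that by blast
  moreover have "t1_space T" if "\<forall>x\<in>\<Omega>. \<forall>y\<in>\<Omega>. closedin T {f \<in> S. f x = y}"
    using t1_space_if_point_sets_closed[OF S assms(3)] that by blast
  ultimately show ?thesis
    unfolding op cl pointwise_subtopology_coarser_iff[OF S assms(3)] by blast
qed

end
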